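(* Let $G$ be a graph, $k$ a positive integer, $\mathcal{F}$ a layered family of $G$ with thickness at most $k$, and $A,B\subseteq V(G)$. Let $f$ be the optimum value of the linear program: minimize $\sum_{F\in\mathcal{F}} x_F$ subject to $x_F\ge 0$ and $\sum_{F\in\mathcal{F},\,F\cap P\ne\emptyset} x_F\ge 1$ for every induced $A$--$B$ path $P$ of $G$. Then for every $\ell\ge \frac16\log 4|\mathcal{F}|$ there exists a multiset $\mathcal{Q}$ of induced $A$--$B$ paths in $G$ of cardinality at least $\ell\cdot f$ such that: for every $F\in\mathcal{F}$ the number of paths in $\mathcal{Q}$ intersecting $F$ is at most $6\ell$; and every path $P\in\mathcal{Q}$ satisfies $|F\cap V(P)|\le 2k-1$ for every $F\in\mathcal{F}$.
   Context: Logarithms are base 2. Layered family: given an ordered partition $\Pi=(L_1,\dots,L_m)$ of $V(G)$, the layer digraph has an arc $(u,v)$ iff $uv\in E(G)$, $u\in L_i$, $v\in L_j$, $j<i$. $v$ is a descendant of $u$ if there is a directed path from $u$ to $v$ (including $v=u$). For every vertex $u$ with no in-arcs, the set of $u$ and all its descendants belongs to $\mathcal{F}$ ($u$ is its center). $\mathcal{F}$ is a layered family of $G$ if it arises this way; its thickness is the smallest $k$ such that each member meets at most $k$ parts of $\Pi$. An $A$--$B$ path starts in $A$ and ends in $B$; a path is induced if it is an induced subgraph. *)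

theory Defs
  imports
    Complex_Main
    "HOL-Library.Multiset"
    "HOL-Library.Disjoint_Sets"
    "Graph_Theory.Graph_Theory"
begin

text \<open>
  Graphs are finite simple graphs, i.e. symmetric loop-free digraphs (locale \<open>pair_graph\<close>):
  an edge \<open>uv\<close> is the pair of arcs \<open>(u,v)\<close>, \<open>(v,u)\<close>.
\<close>

definition ordered_partition :: "'a set \<Rightarrow> 'a set list \<Rightarrow> bool" where
  "ordered_partition V Ls \<longleftrightarrow> distinct Ls \<and> partition_on V (set Ls)"

definition layer_digraph :: "'a pair_pre_digraph \<Rightarrow> 'a set list \<Rightarrow> 'a pair_pre_digraph" where
  "layer_digraph G Ls =
     \<lparr> pverts = pverts G,
       parcs = {(u, v). (u, v) \<in> parcs G \<and>
         (\<exists>i j. i < length Ls \<and> j < i \<and> u \<in> Ls ! i \<and> v \<in> Ls ! j)} \<rparr>"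

definition descendants :: "'a pair_pre_digraph \<Rightarrow> 'a \<Rightarrow> 'a set" where
  "descendants D u = {v. \<exists>p. vpath p (with_proj D) \<and> hd p = u \<and> last p = v}"

definition layered_family :: "'a pair_pre_digraph \<Rightarrow> 'a set list \<Rightarrow> 'a set set" where
  "layered_family G Ls =
     {descendants (layer_digraph G Ls) u | u.
        u \<in> pverts G \<and> in_arcs (with_proj (layer_digraph G Ls)) u = {}}"

definition thickness :: "'a set list \<Rightarrow> 'a set set \<Rightarrow> nat" where
  "thickness Ls \<F> = (LEAST k. \<forall>F\<in>\<F>. card {L \<in> set Ls. F \<inter> L \<noteq> {}} \<le> k)"

definition path_graph :: "'a list \<Rightarrow> 'a pair_pre_digraph" where
  "path_graph p = mk_symmetric (with_proj \<lparr> pverts = set p, parcs = set (vwalk_arcs p) \<rparr>)"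

text \<open>A path is given by its list of vertices; a single vertex of \<open>A \<inter> B\<close> counts.\<close>

definition induced_AB_path ::
    "'a pair_pre_digraph \<Rightarrow> 'a set \<Rightarrow> 'a set \<Rightarrow> 'a list \<Rightarrow> bool" where
  "induced_AB_path G A B p \<longleftrightarrow>
     vpath p (with_proj G) \<and> hd p \<in> A \<and> last p \<in> B \<and>
     induced_subgraph (with_proj (path_graph p)) (with_proj G)"

definition lp_feasible ::
    "'a pair_pre_digraph \<Rightarrow> 'a set set \<Rightarrow> 'a set \<Rightarrow> 'a set \<Rightarrow> ('a set \<Rightarrow> real) \<Rightarrow> bool" where
  "lp_feasible G \<F> A B x \<longleftrightarrow>
     (\<forall>F\<in>\<F>. 0 \<le> x F) \<and>
     (\<forall>P. induced_AB_path G A B P \<longrightarrow> (\<Sum>F | F \<in> \<F> \<and> F \<inter> set P \<noteq> {}. x F) \<ge> 1)"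

definition lp_optimum ::
    "'a pair_pre_digraph \<Rightarrow> 'a set set \<Rightarrow> 'a set \<Rightarrow> 'a set \<Rightarrow> real" where
  "lp_optimum G \<F> A B = Inf {\<Sum>F\<in>\<F>. x F | x. lp_feasible G \<F> A B x}"

text \<open>
  The infimum above is over a nonempty set of nonnegative reals for every layered family
  (as for any feasible bounded linear program, it is then attained).
\<close>

lemma descendants_conv_reachable:
  assumes "pair_wf_digraph D"
  shows "descendants D u = {v. u \<rightarrow>\<^sup>*\<^bsub>with_proj D\<^esub> v}"
proof -
  interpret pair_wf_digraph D by fact
  show ?thesis
    by (auto simp: descendants_def reachable_vpath_conv)
qed

lemma layered_family_covers:
  assumes G: "pair_graph G" and Ls: "ordered_partition (pverts G) Ls" and v: "v \<in> pverts G"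
  shows "\<exists>F\<in>layered_family G Ls. v \<in> F"
proof -
  let ?D = "layer_digraph G Ls"
  interpret G: pair_graph G by fact
  have "pair_wf_digraph ?D"
    by unfold_locales (auto simp: layer_digraph_def dest: G.arc_fst_in_verts G.arc_snd_in_verts)
  then interpret D: pair_wf_digraph ?D .
  have UN: "\<Union>(set Ls) = pverts G"
    using Ls by (simp add: ordered_partition_def partition_on_def)
  have disj: "i = j"
    if "v \<in> Ls ! i" "v \<in> Ls ! j" "i < length Ls" "j < length Ls" for i j v
  proof -
    have "Ls ! i = Ls ! j"
      using that Ls disjointD[of "set Ls" "Ls ! i" "Ls ! j"]
      by (auto simp: ordered_partition_def partition_on_def)
    then show ?thesis
      using that Ls by (simp add: nth_eq_iff_index_eq ordered_partition_def)
  qed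
  have main: "\<exists>u. u \<in> pverts G \<and> in_arcs (with_proj ?D) u = {} \<and> u \<rightarrow>\<^sup>*\<^bsub>with_proj ?D\<^esub> v"
    if "i < length Ls" "v \<in> Ls ! i" for i v
    using that
  proof (induction "length Ls - i" arbitrary: i v rule: less_induct)
    case less
    have v: "v \<in> pverts G"
      using UN less.prems by (metis UnionI nth_mem)
    show ?case
    proof (cases "in_arcs (with_proj ?D) v = {}")
      case True
      moreover have "v \<rightarrow>\<^sup>*\<^bsub>with_proj ?D\<^esub> v"
        using v by (intro D.reachable_refl) (simp add: layer_digraph_def)
      ultimately show ?thesis using v by blast
    next
      case False
      then obtain w where w: "(w, v) \<in> parcs ?D"
        by (auto simp: in_arcs_def)
      then obtain i' j where ij: "i' < length Ls" "j < i'" "w \<in> Ls ! i'" "v \<in> Ls ! j"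
        by (auto simp: layer_digraph_def)
      then have "j = i"
        using disj[OF ij(4) less.prems(2)] less.prems(1) by simp
      then have "length Ls - i' < length Ls - i"
        using ij by simp
      from less.hyps[OF this ij(1,3)] obtain u where
        u: "u \<in> pverts G" "in_arcs (with_proj ?D) u = {}" "u \<rightarrow>\<^sup>*\<^bsub>with_proj ?D\<^esub> w"
        by blast
      moreover have "u \<rightarrow>\<^sup>*\<^bsub>with_proj ?D\<^esub> v"
        using u(3) w D.reachable_trans[OF u(3) D.reachable_adjI, of v] by simp
      ultimately show ?thesis by blast
    qed
  qed
  obtain i where "i < length Ls" "v \<in> Ls ! i"
    using UN v by (metis UnionE in_set_conv_nth)
  from main[OF this] show ?thesis
    by (auto simp: layered_family_def descendants_conv_reachable[OF \<open>pair_wf_digraph ?D\<close>])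
qed

lemma lp_feasible_const_1:
  assumes G: "pair_graph G" and Ls: "ordered_partition (pverts G) Ls"
  shows "lp_feasible G (layered_family G Ls) A B (\<lambda>_. 1)"
proof -
  interpret G: pair_graph G by fact
  have "layered_family G Ls \<subseteq> descendants (layer_digraph G Ls) ` pverts G"
    by (auto simp: layered_family_def)
  then have fin: "finite (layered_family G Ls)"
    by (rule finite_surj[OF G.pair_finite_verts])
  have "\<exists>F. F \<in> layered_family G Ls \<and> F \<inter> set P \<noteq> {}" if "induced_AB_path G A B P" for P
  proof -
    have "P \<noteq> []" "set P \<subseteq> pverts G"
      using that by (auto simp: induced_AB_path_def vpath_def vwalk_def)
    then have "hd P \<in> pverts G" "hd P \<in> set P" by auto
    with layered_family_covers[OF G Ls] show ?thesis by blast
  qed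
  then have "card {F. F \<in> layered_family G Ls \<and> F \<inter> set P \<noteq> {}} \<noteq> 0"
    if "induced_AB_path G A B P" for P
    using that fin by (auto simp: card_eq_0_iff)
  then have "1 \<le> card {F. F \<in> layered_family G Ls \<and> F \<inter> set P \<noteq> {}}"
    if "induced_AB_path G A B P" for P
    using that by (simp add: Suc_le_eq)
  then show ?thesis
    unfolding lp_feasible_def by simp
qed

end

theory Submission
  imports Defs
begin

text \<open>
  The paths are chosen greedily, which replaces linear programming duality and random sampling. For
  an optimum \<open>f \<le> 3\<close>, repeating one path is enough. Otherwise give each member \<open>F\<close> of the family the weight
  \<open>4 ^ n F\<close>, where \<open>n F\<close> counts the paths chosen so far that meet \<open>F\<close>. Rescaling any positive
  weights \<open>w\<close> by the minimum weight of a path gives a feasible solution of the linear program, so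
  some path meets members of total weight at most \<open>w(\<F>) / f\<close>. Adding this path multiplies the
  total weight by at most \<open>1 + 3 / f\<close>, hence after about \<open>l * f\<close> steps it is at most
  \<open>2 powr (12 * l)\<close>, i.e. every \<open>n F\<close> is at most \<open>6 * l\<close>.

  For the bound \<open>2 * k - 1\<close>, let \<open>W\<close> be the set of vertices all of whose family members meet a
  given path. Every ancestor of a vertex of \<open>W\<close> is in \<open>W\<close>, because a family member containing the
  ancestor contains the vertex. A shortest walk from \<open>A\<close> to \<open>B\<close> inside \<open>W\<close> is therefore an induced
  path that meets no new members, and two of its vertices in the same member \<open>F\<close> are joined in \<open>W\<close>
  by a walk with at most \<open>2 * k - 1\<close> vertices through the center of \<open>F\<close>.
\<close>

section \<open>Shortest walks\<close>

text \<open>The relation \<open>E\<close> and the vertex set \<open>W\<close> are kept free, so that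
  one notion covers walks of \<open>G\<close> confined to \<open>W\<close> and directed walks of the
  layer digraph. Vertices may repeat.\<close>

definition walk_in :: "('a \<times> 'a) set \<Rightarrow> 'a set \<Rightarrow> 'a list \<Rightarrow> bool" where
  "walk_in E W p \<longleftrightarrow> p \<noteq> [] \<and> set p \<subseteq> W \<and> successively (\<lambda>u v. (u, v) \<in> E) p"

definition shortest_walk ::
    "('a \<times> 'a) set \<Rightarrow> 'a set \<Rightarrow> 'a set \<Rightarrow> 'a set \<Rightarrow> 'a list \<Rightarrow> bool" where
  "shortest_walk E W A B p \<longleftrightarrow> walk_in E W p \<and> hd p \<in> A \<and> last p \<in> B \<and>
     (\<forall>q. walk_in E W q \<longrightarrow> hd q \<in> A \<longrightarrow> last q \<in> B \<longrightarrow> length p \<le> length q)"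

lemma vwalk_arcs_subset_iff_successively:
  "set (vwalk_arcs p) \<subseteq> E \<longleftrightarrow> successively (\<lambda>u v. (u, v) \<in> E) p"
  by (induction p rule: vwalk_arcs.induct) auto

lemma vwalk_arcs_infix: "(u, v) \<in> set (vwalk_arcs (xs @ u # v # zs))"
proof (induction xs)
  case (Cons x xs)
  then show ?case by (cases xs) auto
qed simp

lemma vwalk_with_proj_iff_walk_in: "vwalk p (with_proj G) \<longleftrightarrow> walk_in (parcs G) (pverts G) p"
  by (auto simp: vwalk_def walk_in_def vwalk_arcs_subset_iff_successively)

lemma exists_shortest_walk:
  assumes "walk_in E W p" "hd p \<in> A" "last p \<in> B"
  shows "\<exists>q. shortest_walk E W A B q"
  using ex_has_least_nat[of "\<lambda>p. walk_in E W p \<and> hd p \<in> A \<and> last p \<in> B" p length] assms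
  unfolding shortest_walk_def by blast

lemma walk_in_replace_segment:
  assumes "walk_in E W (xs @ u # ys @ v # zs)"
    and "walk_in E W r" "hd r = u" "last r = v"
  shows "walk_in E W (xs @ r @ zs)"
    and "hd (xs @ r @ zs) = hd (xs @ u # ys @ v # zs)"
    and "last (xs @ r @ zs) = last (xs @ u # ys @ v # zs)"
  using assms by (auto simp: walk_in_def successively_append_iff successively_Cons hd_append)

text \<open>Splicing \<open>r\<close> in place of the stretch from \<open>u\<close> to
  \<open>v\<close> keeps both ends of the whole walk, so the result competes with the shortest one.
  The stretch has \<open>length ys + 2\<close> vertices, counting \<open>u\<close> and
  \<open>v\<close>.\<close>

lemma shortest_walk_segment:
  assumes p: "shortest_walk E W A B (xs @ u # ys @ v # zs)"
    and r: "walk_in E W r" "hd r = u" "last r = v"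
  shows "length ys + 2 \<le> length r"
proof -
  have "walk_in E W (xs @ u # ys @ v # zs)"
    using p by (simp add: shortest_walk_def)
  from walk_in_replace_segment[OF this r] p
  have "length (xs @ u # ys @ v # zs) \<le> length (xs @ r @ zs)"
    unfolding shortest_walk_def by metis
  then show ?thesis by simp
qed

lemma shortest_walk_distinct:
  assumes "shortest_walk E W A B p"
  shows "distinct p"
proof (rule ccontr)
  assume "\<not> distinct p"
  then obtain xs u ys zs where p: "p = xs @ u # ys @ u # zs"
    using not_distinct_decomp by fastforce
  \<comment> \<open>The one-vertex walk replaces the closed stretch from \<open>u\<close> back to
    \<open>u\<close>, which has at least two entries.\<close>
  then have "walk_in E W [u]"
    using assms by (auto simp: shortest_walk_def walk_in_def)
  from shortest_walk_segment[OF _ this] show False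
    using assms p by fastforce
qed

text \<open>A forward edge is a walk with two vertices, so nothing can lie between its ends on a
  shortest walk.\<close>

lemma shortest_walk_chord:
  assumes p: "shortest_walk E W A B (xs @ u # ys @ v # zs)" and "(u, v) \<in> E"
  shows "(u, v) \<in> set (vwalk_arcs (xs @ u # ys @ v # zs))"
proof -
  have "walk_in E W [u, v]"
    using assms by (auto simp: shortest_walk_def walk_in_def)
  from shortest_walk_segment[OF p this] have "ys = []" by simp
  then show ?thesis by (simp add: vwalk_arcs_infix)
qed

lemma shortest_walk_induced:
  assumes p: "shortest_walk E W A B p" and "sym E" "irrefl E"
    and uv: "(u, v) \<in> E" "u \<in> set p" "v \<in> set p"
  shows "(u, v) \<in> set (vwalk_arcs p) \<or> (v, u) \<in> set (vwalk_arcs p)"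
proof -
  have "u \<noteq> v" using assms by (auto simp: irrefl_def)
  have vu: "(v, u) \<in> E" using assms by (auto dest: symD)
  obtain xs zs where xz: "p = xs @ u # zs"
    using uv by (meson split_list)
  then consider "v \<in> set xs" | "v \<in> set zs"
    using uv \<open>u \<noteq> v\<close> by auto
  then show ?thesis
  proof cases
    case 1
    then obtain as bs where "xs = as @ v # bs" by (meson split_list)
    then have "p = as @ v # bs @ u # zs" using xz by simp
    then show ?thesis using shortest_walk_chord p vu by metis
  next
    case 2
    then obtain as bs where "zs = as @ v # bs" by (meson split_list)
    then have "p = xs @ u # as @ v # bs" using xz by simp
    then show ?thesis using shortest_walk_chord p uv by metis
  qed
qed

text \<open>All vertices of \<open>p\<close> in \<open>F\<close> lie between the first and the last
  of them, and this stretch is no longer than a walk \<open>r\<close> joining these two.\<close>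

lemma shortest_walk_card_inter_le:
  assumes p: "shortest_walk E W A B p" and "1 \<le> m"
    and short: "\<And>u v. \<lbrakk>u \<in> F \<inter> set p; v \<in> F \<inter> set p\<rbrakk> \<Longrightarrow>
      \<exists>r. walk_in E W r \<and> hd r = u \<and> last r = v \<and> length r \<le> m"
  shows "card (F \<inter> set p) \<le> m"
proof (cases "F \<inter> set p = {}")
  case False
  then have "\<exists>u\<in>set p. u \<in> F" by blast
  then obtain xs u ps where xs: "p = xs @ u # ps" "u \<in> F" "\<forall>x\<in>set xs. x \<notin> F"
    using split_list_first_prop[of p "\<lambda>x. x \<in> F"] by blast
  show ?thesis
  proof (cases "\<exists>v\<in>set ps. v \<in> F")
    case False
    then have "F \<inter> set p \<subseteq> {u}" using xs by auto
    then have "card (F \<inter> set p) \<le> 1" using card_mono[of "{u}"] by fastforce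
    then show ?thesis using \<open>1 \<le> m\<close> by simp
  next
    case True
    then obtain ys v zs where ys: "ps = ys @ v # zs" "v \<in> F" "\<forall>x\<in>set zs. x \<notin> F"
      using split_list_last_prop[of ps "\<lambda>x. x \<in> F"] by blast
    obtain r where r: "walk_in E W r" "hd r = u" "last r = v" "length r \<le> m"
      using short[of u v] xs ys by auto
    have "F \<inter> set p \<subseteq> set (u # ys @ [v])" using xs ys by auto
    then have "card (F \<inter> set p) \<le> card (set (u # ys @ [v]))"
      by (intro card_mono) auto
    also have "\<dots> \<le> length ys + 2"
      using card_length[of "u # ys @ [v]"] by simp
    also have "\<dots> \<le> length r"
      using shortest_walk_segment[OF _ r(1-3)] p xs ys by simp
    finally show ?thesis using r by simp
  qed
qed simp

text \<open>The path is induced in all of \<open>G\<close>, although it is shortest only inside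
  \<open>W\<close>: an edge of \<open>G\<close> between two of its vertices has both ends in
  \<open>W\<close> and so is an admissible shortcut.\<close>

lemma induced_AB_path_shortest_walk:
  assumes G: "pair_graph G" and W: "W \<subseteq> pverts G"
    and p: "shortest_walk (parcs G) W A B p"
  shows "induced_AB_path G A B p"
proof -
  interpret G: pair_graph G by fact
  have walk: "walk_in (parcs G) W p" "hd p \<in> A" "last p \<in> B"
    using p by (auto simp: shortest_walk_def)
  have sym: "sym (parcs G)"
    using G.sym_arcs by (simp add: symmetric_def)
  have irr: "irrefl (parcs G)"
    using G.pair_no_loops by (force simp: irrefl_def)
  have sub: "set p \<subseteq> pverts G" "set (vwalk_arcs p) \<subseteq> parcs G"
    using walk W by (auto simp: walk_in_def vwalk_arcs_subset_iff_successively[symmetric])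
  have ends: "fst e \<in> set p \<and> snd e \<in> set p" if "e \<in> set (vwalk_arcs p)" for e
    using that by (induction p rule: vwalk_arcs.induct) auto
  have parcs: "parcs (path_graph p) = {e \<in> parcs G. fst e \<in> set p \<and> snd e \<in> set p}"
  proof (rule set_eqI, rule iffI)
    fix e assume "e \<in> parcs (path_graph p)"
    then obtain u v where e: "e = (u, v)"
      and uv: "(u, v) \<in> set (vwalk_arcs p) \<or> (v, u) \<in> set (vwalk_arcs p)"
      by (cases e) (auto simp: path_graph_def parcs_mk_symmetric)
    from uv show "e \<in> {e \<in> parcs G. fst e \<in> set p \<and> snd e \<in> set p}"
      using sub(2) ends[of "(u, v)"] ends[of "(v, u)"] symD[OF sym, of v u] e by auto
  next
    fix e assume e: "e \<in> {e \<in> parcs G. fst e \<in> set p \<and> snd e \<in> set p}"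
    obtain u v where uv: "e = (u, v)" by (cases e)
    then have "(u, v) \<in> set (vwalk_arcs p) \<or> (v, u) \<in> set (vwalk_arcs p)"
      using e shortest_walk_induced[OF p sym irr, of u v] by auto
    then show "e \<in> parcs (path_graph p)"
      by (auto simp: uv path_graph_def parcs_mk_symmetric
        intro: bexI[of _ "(u, v)"] bexI[of _ "(v, u)"])
  qed
  have pverts: "pverts (path_graph p) = set p"
    by (simp add: path_graph_def)
  have "pair_wf_digraph (path_graph p)"
    by unfold_locales (auto simp: parcs pverts)
  then have "induced_subgraph (with_proj (path_graph p)) (with_proj G)"
    using sub by (auto simp: induced_subgraph_def subgraph_def compatible_def parcs pverts
      wf_digraph_wp_iff G.pair_wf_digraph_axioms)
  moreover have "vpath p (with_proj G)"
    using walk W shortest_walk_distinct[OF p]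
    by (auto simp: vpath_def vwalk_with_proj_iff_walk_in walk_in_def)
  ultimately show ?thesis
    using walk by (simp add: induced_AB_path_def)
qed

section \<open>Layered families\<close>

lemma layer_index_unique:
  assumes "ordered_partition V Ls" "i < length Ls" "j < length Ls" "v \<in> Ls ! i" "v \<in> Ls ! j"
  shows "i = j"
proof -
  have "Ls ! i = Ls ! j"
    using assms disjointD[of "set Ls" "Ls ! i" "Ls ! j"]
    by (auto simp: ordered_partition_def partition_on_def)
  then show ?thesis
    using assms by (simp add: nth_eq_iff_index_eq ordered_partition_def)
qed

lemma pair_wf_digraph_layer_digraph:
  assumes "pair_graph G"
  shows "pair_wf_digraph (layer_digraph G Ls)"
proof -
  interpret pair_graph G by fact
  show ?thesis
    by unfold_locales (auto simp: layer_digraph_def dest: arc_fst_in_verts arc_snd_in_verts)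
qed

text \<open>The layer index drops along every arc, so the vertices of a directed walk lie in
  pairwise different layers, each of which meets \<open>F\<close>.\<close>

lemma layer_digraph_walk_length_le:
  assumes Ls: "ordered_partition (pverts G) Ls"
    and p: "walk_in (parcs (layer_digraph G Ls)) (pverts G) p" and "set p \<subseteq> F"
  shows "length p \<le> card {L \<in> set Ls. F \<inter> L \<noteq> {}}"
proof -
  define lay where "lay v = (SOME i. i < length Ls \<and> v \<in> Ls ! i)" for v
  have lay: "lay v < length Ls \<and> v \<in> Ls ! lay v" if "v \<in> pverts G" for v
  proof -
    have "\<exists>i. i < length Ls \<and> v \<in> Ls ! i"
      using Ls that unfolding ordered_partition_def partition_on_def
      by (metis UnionE in_set_conv_nth)
    then show ?thesis unfolding lay_def by (rule someI_ex)
  qed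
  have lay_less: "lay v < lay u"
    if uv: "u \<in> pverts G" "v \<in> pverts G" "(u, v) \<in> parcs (layer_digraph G Ls)" for u v
  proof -
    obtain i j where "i < length Ls" "j < i" "u \<in> Ls ! i" "v \<in> Ls ! j"
      using uv by (auto simp: layer_digraph_def)
    then have "lay u = i" "lay v = j"
      using lay[OF uv(1)] lay[OF uv(2)] layer_index_unique[OF Ls] by (metis order.strict_trans)+
    then show ?thesis using \<open>j < i\<close> by simp
  qed
  have "successively (\<lambda>u v. lay v < lay u) p"
    using p lay_less unfolding walk_in_def by (auto elim!: successively_mono)
  then have "successively (>) (map lay p)"
    by (simp add: successively_map)
  then have "sorted_wrt (>) (map lay p)"
    by (subst (asm) successively_conv_sorted_wrt) (auto intro: transpI)
  then have "distinct (map lay p)"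
    by (induction p) fastforce+
  \<comment> \<open>\<open>Ls\<close> has no repeated entries, so counting indices amounts to
    counting layers.\<close>
  moreover have "inj_on ((!) Ls) (set (map lay p))"
    using Ls p lay
    by (auto simp: inj_on_def walk_in_def ordered_partition_def nth_eq_iff_index_eq subset_iff)
  ultimately have "distinct (map (\<lambda>v. Ls ! lay v) p)"
    by (simp add: distinct_map inj_on_def)
  then have "length p = card (set (map (\<lambda>v. Ls ! lay v) p))"
    by (metis distinct_card length_map)
  also have "\<dots> \<le> card {L \<in> set Ls. F \<inter> L \<noteq> {}}"
    using p lay \<open>set p \<subseteq> F\<close> by (intro card_mono) (auto simp: walk_in_def)
  finally show ?thesis .
qed

lemma card_layers_le_thickness:
  assumes "F \<in> \<F>"
  shows "card {L \<in> set Ls. F \<inter> L \<noteq> {}} \<le> thickness Ls \<F>"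
proof -
  \<comment> \<open>The number of all layers is one admissible bound, so the \<open>LEAST\<close> in
    the definition of thickness is attained.\<close>
  have "\<forall>F\<in>\<F>. card {L \<in> set Ls. F \<inter> L \<noteq> {}} \<le> card (set Ls)"
    by (auto intro!: card_mono)
  then have "\<forall>F\<in>\<F>. card {L \<in> set Ls. F \<inter> L \<noteq> {}} \<le> thickness Ls \<F>"
    unfolding thickness_def by (rule LeastI)
  then show ?thesis using assms by blast
qed

lemma layered_family_descendant_closed:
  assumes G: "pair_graph G" and "F \<in> layered_family G Ls"
    and "w \<in> F" "w \<rightarrow>\<^sup>*\<^bsub>with_proj (layer_digraph G Ls)\<^esub> u"
  shows "u \<in> F"
proof -
  interpret D: pair_wf_digraph "layer_digraph G Ls"
    using pair_wf_digraph_layer_digraph[OF G] .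
  show ?thesis
    using assms D.reachable_trans
    by (auto simp: layered_family_def descendants_conv_reachable[OF D.pair_wf_digraph_axioms])
qed

lemma walk_in_reachable:
  assumes D: "pair_wf_digraph D" and p: "walk_in (parcs D) (pverts D) p" and "w \<in> set p"
  shows "hd p \<rightarrow>\<^sup>*\<^bsub>with_proj D\<^esub> w" and "w \<rightarrow>\<^sup>*\<^bsub>with_proj D\<^esub> last p"
proof -
  interpret D: pair_wf_digraph D by fact
  obtain xs zs where xz: "p = xs @ w # zs"
    using \<open>w \<in> set p\<close> by (meson split_list)
  have "vwalk (xs @ [w]) (with_proj D)" "vwalk (w # zs) (with_proj D)"
    using p xz by (auto simp: vwalk_with_proj_iff_walk_in walk_in_def successively_append_iff)
  moreover have "hd (xs @ [w]) = hd p" "last (w # zs) = last p"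
    using xz by (auto simp: hd_append)
  ultimately show "hd p \<rightarrow>\<^sup>*\<^bsub>with_proj D\<^esub> w" "w \<rightarrow>\<^sup>*\<^bsub>with_proj D\<^esub> last p"
    unfolding D.reachable_vwalk_conv by (metis last_snoc, metis list.sel(1))
qed

text \<open>The walk climbs from \<open>u\<close> to the center \<open>c\<close> against the arcs
  and descends to \<open>v\<close>. Each leg has at most \<open>k\<close> vertices, and
  \<open>c\<close> is counted once.\<close>

lemma layered_family_short_walk:
  assumes G: "pair_graph G" and Ls: "ordered_partition (pverts G) Ls"
    and F: "F \<in> layered_family G Ls"
    and k: "thickness Ls (layered_family G Ls) \<le> k"
    and W: "\<And>w u. \<lbrakk>w \<in> pverts G; u \<in> W; w \<rightarrow>\<^sup>*\<^bsub>with_proj (layer_digraph G Ls)\<^esub> u\<rbrakk> \<Longrightarrow> w \<in> W"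
    and uv: "u \<in> F" "v \<in> F" "u \<in> W" "v \<in> W"
  shows "\<exists>r. walk_in (parcs G) W r \<and> hd r = u \<and> last r = v \<and> length r \<le> 2 * k - 1"
proof -
  let ?D = "layer_digraph G Ls"
  interpret G: pair_graph G by fact
  have D: "pair_wf_digraph ?D"
    using pair_wf_digraph_layer_digraph[OF G] .
  have sym: "sym (parcs G)"
    using G.sym_arcs by (simp add: symmetric_def)
  have vertsD: "pverts ?D = pverts G" and arcsD: "parcs ?D \<subseteq> parcs G"
    by (auto simp: layer_digraph_def)
  obtain c where c: "F = descendants ?D c"
    using F by (auto simp: layered_family_def)
  have leg: "\<exists>p. p \<noteq> [] \<and> hd p = c \<and> last p = x \<and> walk_in (parcs G) W p \<and> length p \<le> k"
    if x: "x \<in> F" "x \<in> W" for x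
  proof -
    obtain p where p: "vpath p (with_proj ?D)" "hd p = c" "last p = x"
      using c x by (auto simp: descendants_def)
    then have walk: "walk_in (parcs ?D) (pverts ?D) p"
      by (simp add: vpath_def vwalk_with_proj_iff_walk_in)
    note reach = walk_in_reachable[OF D walk]
    have "set p \<subseteq> F"
      using reach p c by (auto simp: descendants_conv_reachable[OF D])
    then have "length p \<le> k"
      using layer_digraph_walk_length_le[OF Ls, of p F] walk k vertsD
        card_layers_le_thickness[OF F, of Ls] by simp
    \<comment> \<open>Every vertex of the leg is an ancestor of its end \<open>x\<close>, which lies
      in \<open>W\<close>.\<close>
    moreover have "set p \<subseteq> W"
      using reach p x W walk vertsD by (auto simp: walk_in_def)
    ultimately show ?thesis
      using p walk arcsD by (auto simp: walk_in_def elim!: successively_mono)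
  qed
  obtain p where p: "p \<noteq> []" "hd p = c" "last p = u" "walk_in (parcs G) W p" "length p \<le> k"
    using leg uv by blast
  obtain q where q: "q \<noteq> []" "hd q = c" "last q = v" "walk_in (parcs G) W q" "length q \<le> k"
    using leg uv by blast
  obtain q' where q': "q = c # q'"
    using q by (cases q) auto
  have "successively (\<lambda>u v. (v, u) \<in> parcs G) p"
    using p by (auto simp: walk_in_def elim!: successively_mono intro: symD[OF sym])
  then have "walk_in (parcs G) W (rev p @ q')"
    using p q q' by (auto simp: walk_in_def successively_append_iff successively_Cons last_rev)
  moreover have "hd (rev p @ q') = u" "last (rev p @ q') = v"
    using p q q' by (auto simp: hd_rev last_rev)
  moreover have "length (rev p @ q') \<le> 2 * k - 1"
    using p q q' by simp
  ultimately show ?thesis by blast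
qed

lemma induced_AB_path_thin_replacement:
  assumes G: "pair_graph G" and "k > 0" and Ls: "ordered_partition (pverts G) Ls"
    and k: "thickness Ls (layered_family G Ls) \<le> k"
    and P: "induced_AB_path G A B P"
  shows "\<exists>P'. induced_AB_path G A B P' \<and>
    (\<forall>F\<in>layered_family G Ls. F \<inter> set P' \<noteq> {} \<longrightarrow> F \<inter> set P \<noteq> {}) \<and>
    (\<forall>F\<in>layered_family G Ls. card (F \<inter> set P') \<le> 2 * k - 1)"
proof -
  define W where "W = {v \<in> pverts G. \<forall>F\<in>layered_family G Ls. v \<in> F \<longrightarrow> F \<inter> set P \<noteq> {}}"
  \<comment> \<open>A member containing a vertex of \<open>P\<close> meets \<open>P\<close>, so
    \<open>P\<close> itself runs inside \<open>W\<close> and a shortest walk there exists.\<close>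
  have "walk_in (parcs G) W P" "hd P \<in> A" "last P \<in> B"
    using P by (auto simp: induced_AB_path_def vpath_def vwalk_with_proj_iff_walk_in
      walk_in_def W_def)
  then obtain q where q: "shortest_walk (parcs G) W A B q"
    using exists_shortest_walk by blast
  then have qW: "set q \<subseteq> W"
    by (simp add: shortest_walk_def walk_in_def)
  have closed: "w \<in> W"
    if "w \<in> pverts G" "u \<in> W" "w \<rightarrow>\<^sup>*\<^bsub>with_proj (layer_digraph G Ls)\<^esub> u" for w u
  proof -
    have "F \<inter> set P \<noteq> {}" if F: "F \<in> layered_family G Ls" "w \<in> F" for F
      using layered_family_descendant_closed[OF G F \<open>w \<rightarrow>\<^sup>*\<^bsub>_\<^esub> u\<close>]
        \<open>u \<in> W\<close> F(1) by (simp add: W_def)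
    then show ?thesis using \<open>w \<in> pverts G\<close> by (simp add: W_def)
  qed
  have "induced_AB_path G A B q"
    using induced_AB_path_shortest_walk[OF G _ q] by (auto simp: W_def)
  moreover have "F \<inter> set P \<noteq> {}" if "F \<in> layered_family G Ls" "F \<inter> set q \<noteq> {}" for F
    using that qW by (auto simp: W_def)
  moreover have "card (F \<inter> set q) \<le> 2 * k - 1" if "F \<in> layered_family G Ls" for F
  proof (rule shortest_walk_card_inter_le[OF q])
    show "1 \<le> 2 * k - 1" using \<open>k > 0\<close> by simp
    show "\<exists>r. walk_in (parcs G) W r \<and> hd r = u \<and> last r = v \<and> length r \<le> 2 * k - 1"
      if "u \<in> F \<inter> set q" "v \<in> F \<inter> set q" for u v
    proof (rule layered_family_short_walk[OF G Ls \<open>F \<in> layered_family G Ls\<close> k])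
      show "u \<in> F" "v \<in> F" "u \<in> W" "v \<in> W" using that qW by auto
    qed (rule closed)
  qed
  ultimately show ?thesis by blast
qed

section \<open>Greedy packing\<close>

text \<open>The total weight is the potential. A hit turns a weight \<open>w F\<close> into
  \<open>4 * w F\<close>, a gain of \<open>3 * w F\<close>, and the members hit by a light path
  carry at most a fraction \<open>1 / f\<close> of the total.\<close>

lemma greedy_packing:
  fixes f :: real and hit :: "'p \<Rightarrow> 'f \<Rightarrow> bool"
  assumes fin: "finite \<F>" and f: "f > 0"
    and light: "\<And>w :: 'f \<Rightarrow> real. (\<And>F. F \<in> \<F> \<Longrightarrow> w F > 0) \<Longrightarrow>
      \<exists>P\<in>C. f * (\<Sum>F | F \<in> \<F> \<and> hit P F. w F) \<le> (\<Sum>F\<in>\<F>. w F)"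
  shows "\<exists>Q. size Q = t \<and> set_mset Q \<subseteq> C \<and>
    (\<Sum>F\<in>\<F>. 4 ^ size {#P \<in># Q. hit P F#}) \<le> real (card \<F>) * (1 + 3 / f) ^ t"
proof (induction t)
  case 0
  show ?case by (intro exI[of _ "{#}"]) simp
next
  case (Suc t)
  then obtain Q where Q: "size Q = t" "set_mset Q \<subseteq> C"
    "(\<Sum>F\<in>\<F>. 4 ^ size {#P \<in># Q. hit P F#}) \<le> real (card \<F>) * (1 + 3 / f) ^ t"
    by blast
  define w where "w F = (4 :: real) ^ size {#P \<in># Q. hit P F#}" for F
  obtain P where P: "P \<in> C" "f * (\<Sum>F | F \<in> \<F> \<and> hit P F. w F) \<le> (\<Sum>F\<in>\<F>. w F)"
    using light[of w] by (auto simp: w_def)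
  have "(\<Sum>F\<in>\<F>. 4 ^ size {#P' \<in># add_mset P Q. hit P' F#}) =
      (\<Sum>F\<in>\<F>. w F + (if hit P F then 3 * w F else 0))"
    by (intro sum.cong) (auto simp: w_def)
  also have "\<dots> = (\<Sum>F\<in>\<F>. w F) + 3 * (\<Sum>F | F \<in> \<F> \<and> hit P F. w F)"
    using fin by (simp add: sum.distrib sum.inter_filter[symmetric] sum_distrib_left)
  also have "\<dots> \<le> (\<Sum>F\<in>\<F>. w F) * (1 + 3 / f)"
    using P(2) f by (simp add: field_simps)
  also have "\<dots> \<le> real (card \<F>) * (1 + 3 / f) ^ t * (1 + 3 / f)"
    using Q(3) f by (intro mult_right_mono) (auto simp: w_def)
  finally show ?case
    using Q P by (intro exI[of _ "add_mset P Q"]) (auto simp: algebra_simps)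
qed

section \<open>The linear program and light paths\<close>

lemma bdd_below_lp_values: "bdd_below {\<Sum>F\<in>\<F>. x F | x. lp_feasible G \<F> A B x}"
  by (rule bdd_belowI[of _ 0]) (auto simp: lp_feasible_def intro: sum_nonneg)

lemma lp_optimum_le: "lp_feasible G \<F> A B x \<Longrightarrow> lp_optimum G \<F> A B \<le> (\<Sum>F\<in>\<F>. x F)"
  unfolding lp_optimum_def by (rule cInf_lower[OF _ bdd_below_lp_values]) blast

text \<open>Dividing \<open>w\<close> by the smallest weight of a path gives a feasible solution,
  whose value is at least the optimum.\<close>

lemma exists_light_path:
  assumes fin: "finite \<F>" and P0: "induced_AB_path G A B P0"
    and hits: "\<And>P. induced_AB_path G A B P \<Longrightarrow> \<exists>F\<in>\<F>. F \<inter> set P \<noteq> {}"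
    and w: "\<And>F. F \<in> \<F> \<Longrightarrow> w F > 0"
  shows "\<exists>P. induced_AB_path G A B P \<and>
    lp_optimum G \<F> A B * (\<Sum>F | F \<in> \<F> \<and> F \<inter> set P \<noteq> {}. w F) \<le> (\<Sum>F\<in>\<F>. w F)"
proof -
  define g where "g P = (\<Sum>F | F \<in> \<F> \<and> F \<inter> set P \<noteq> {}. w F)" for P
  define M where "M = g ` {P. induced_AB_path G A B P}"
  \<comment> \<open>Path weights are sums over subfamilies of a finite family, so they take finitely
    many values and a minimum exists.\<close>
  have "M \<subseteq> sum w ` Pow \<F>"
    by (auto simp: M_def g_def)
  then have finM: "finite M"
    using fin by (auto intro: finite_subset)
  have "M \<noteq> {}" using P0 by (auto simp: M_def)
  then obtain P where P: "induced_AB_path G A B P" "g P = Min M"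
    using Min_in[OF finM] by (auto simp: M_def)
  have min: "g P \<le> g P'" if "induced_AB_path G A B P'" for P'
    using that P finM by (auto simp: M_def)
  have pos: "g P > 0"
    unfolding g_def using fin w hits[OF P(1)] by (intro sum_pos) auto
  have "lp_feasible G \<F> A B (\<lambda>F. w F / g P)"
    unfolding lp_feasible_def
    using w pos min by (auto simp: sum_divide_distrib[symmetric] g_def[symmetric] less_imp_le)
  from lp_optimum_le[OF this] have "lp_optimum G \<F> A B * g P \<le> (\<Sum>F\<in>\<F>. w F)"
    using pos by (simp add: sum_divide_distrib[symmetric] field_simps)
  then show ?thesis using P by (auto simp: g_def)
qed

section \<open>Numerical estimates for the total weight\<close>

lemma half_le_ln_2: "1 / 2 \<le> ln (2 :: real)"
proof -
  have "exp (1 :: real) \<le> 3" using exp_le by simp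
  then have "exp (1 :: real) \<le> 2 ^ 2" by simp
  then have "1 \<le> ln ((2 :: real) ^ 2)" by (subst ln_ge_iff) auto
  then show ?thesis using ln_realpow[of 2 2] by simp
qed

lemma greedy_weight_bound:
  fixes l f :: real and c n t :: nat
  assumes weight: "4 ^ n \<le> real c * (1 + 3 / f) ^ t" and f: "3 \<le> f"
    and t: "real t \<le> l * f + 1" and c: "real c \<le> 2 powr (6 * l - 2)" and l: "0 \<le> l"
  shows "real n \<le> 6 * l"
proof -
  have "3 / f * real t \<le> 3 / f * (l * f + 1)"
    using t f by (intro mult_left_mono) auto
  \<comment> \<open>Rounding the number of steps up costs at most \<open>3 / f\<close>, which is at
    most 1 because \<open>f\<close> is at least 3.\<close>
  also have "\<dots> \<le> 3 * l + 1"
    using f by (simp add: field_simps)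
  also have "\<dots> = (6 * l + 2) * (1 / 2)" by simp
  also have "\<dots> \<le> (6 * l + 2) * ln 2"
    using l by (intro mult_left_mono half_le_ln_2) simp
  finally have exponent: "3 / f * real t \<le> (6 * l + 2) * ln 2" .
  have "(1 + 3 / f) ^ t \<le> exp (3 / f) ^ t"
    using f exp_ge_add_one_self[of "3 / f"] by (intro power_mono) auto
  also have "\<dots> = exp (3 / f * real t)"
    by (simp add: exp_of_nat_mult[symmetric] mult.commute)
  also have "\<dots> \<le> 2 powr (6 * l + 2)"
    using exponent by (simp add: powr_def)
  \<comment> \<open>The \<open>- 2\<close> in the bound on \<open>c\<close> cancels the
    \<open>+ 2\<close> caused by rounding, leaving the exponent \<open>12 * l\<close>.\<close>
  finally have "real c * (1 + 3 / f) ^ t \<le> 2 powr (6 * l - 2) * 2 powr (6 * l + 2)"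
    using c f by (intro mult_mono) auto
  then have "(4 :: real) ^ n \<le> 2 powr (12 * l)"
    using weight by (simp add: powr_add[symmetric])
  moreover have "(4 :: real) ^ n = 2 powr (2 * real n)"
    by (simp add: powr_powr[symmetric] powr_realpow[symmetric])
  ultimately have "2 powr (2 * real n) \<le> (2 :: real) powr (12 * l)" by simp
  then have "2 * real n \<le> 12 * l" by (subst (asm) powr_le_cancel_iff) auto
  then show ?thesis by simp
qed

theorem theorem5p1:
  fixes G :: "'a pair_pre_digraph" and k :: nat
    and Ls :: "'a set list" and \<F> :: "'a set set"
    and A B :: "'a set" and l :: real
  assumes "pair_graph G"
    and "k > 0"
    and "ordered_partition (pverts G) Ls"
    and "\<F> = layered_family G Ls"
    and "thickness Ls \<F> \<le> k"
    and "A \<subseteq> pverts G" and "B \<subseteq> pverts G"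
    and "l \<ge> 1 / 6 * log 2 (4 * real (card \<F>))"
  shows "\<exists>Q :: 'a list multiset.
           (\<forall>P \<in># Q. induced_AB_path G A B P) \<and>
           real (size Q) \<ge> l * lp_optimum G \<F> A B \<and>
           (\<forall>F\<in>\<F>. real (size {#P \<in># Q. set P \<inter> F \<noteq> {}#}) \<le> 6 * l) \<and>
           (\<forall>P \<in># Q. \<forall>F\<in>\<F>. card (F \<inter> set P) \<le> 2 * k - 1)"
proof -
  interpret G: pair_graph G by fact
  define f where "f = lp_optimum G \<F> A B"
  have "\<F> \<subseteq> descendants (layer_digraph G Ls) ` pverts G"
    using assms(4) by (auto simp: layered_family_def)
  then have fin: "finite \<F>"
    by (rule finite_surj[OF G.pair_finite_verts])
  have hits: "\<exists>F\<in>\<F>. F \<inter> set P \<noteq> {}" if "induced_AB_path G A B P" for P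
  proof -
    have "hd P \<in> pverts G" "hd P \<in> set P"
      using that by (auto simp: induced_AB_path_def vpath_def vwalk_def)
    then show ?thesis
      using layered_family_covers[OF assms(1,3)] assms(4) by blast
  qed
  show ?thesis
  proof (cases "\<exists>P. induced_AB_path G A B P")
    case False
    then have "lp_feasible G \<F> A B (\<lambda>_. 0)"
      by (simp add: lp_feasible_def)
    from lp_optimum_le[OF this] have "f \<le> 0"
      by (simp add: f_def)
    moreover have "0 \<le> log 2 (4 * real (card \<F>))"
      \<comment> \<open>For an empty family the logarithm is taken at 0, where its value is 0 by
        convention.\<close>
      by (cases "card \<F> = 0") (auto simp: log_def)
    then have "0 \<le> l" using assms(8) by linarith
    ultimately show ?thesis
      by (intro exI[of _ "{#}"]) (auto simp: f_def mult_nonneg_nonpos)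
  next
    case True
    then obtain P0 where P0: "induced_AB_path G A B P0" by blast
    define C where "C = {P. induced_AB_path G A B P \<and> (\<forall>F\<in>\<F>. card (F \<inter> set P) \<le> 2 * k - 1)}"
    have thin: "\<exists>P'\<in>C. \<forall>F\<in>\<F>. F \<inter> set P' \<noteq> {} \<longrightarrow> F \<inter> set P \<noteq> {}"
      if "induced_AB_path G A B P" for P
      using induced_AB_path_thin_replacement[OF assms(1-3) _ that] assms(4,5)
      by (auto simp: C_def)
    have "\<F> \<noteq> {}" using hits[OF P0] by auto
    then have card: "1 \<le> real (card \<F>)"
      using fin by (simp add: Suc_le_eq card_gt_0_iff)
    have "log 2 (4 * real (card \<F>)) = log 2 (real (card \<F>)) + 2"
      using card log_pow_cancel[of 2 2] by (simp add: log_mult)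
    then have log_card: "log 2 (real (card \<F>)) \<le> 6 * l - 2"
      using assms(8) by simp
    then have card_le: "real (card \<F>) \<le> 2 powr (6 * l - 2)"
      using card by (subst (asm) log_le_iff) auto
    have "0 \<le> log 2 (real (card \<F>))" using card by simp
    then have l: "1 / 3 \<le> l" using log_card by linarith
    have "\<exists>Q. set_mset Q \<subseteq> C \<and> l * f \<le> real (size Q) \<and>
      (\<forall>F\<in>\<F>. real (size {#P \<in># Q. set P \<inter> F \<noteq> {}#}) \<le> 6 * l)"
    proof (cases "f \<le> 3")
      case True
      obtain P where "P \<in> C" using thin[OF P0] by blast
      define t where "t = nat \<lceil>3 * l\<rceil>"
      \<comment> \<open>Since \<open>3 * l\<close> is at least 1, rounding it up gives at most
        \<open>3 * l + 1\<close>, hence at most \<open>6 * l\<close>.\<close>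
      have t: "3 * l \<le> real t" "real t \<le> 6 * l"
        using l unfolding t_def by linarith+
      have "l * f \<le> l * 3"
        using True l by (intro mult_left_mono) auto
      then have "l * f \<le> real t" using t by linarith
      moreover have "real (size {#P' \<in># replicate_mset t P. set P' \<inter> F \<noteq> {}#}) \<le> 6 * l" for F
        using size_filter_mset_lesseq[of _ "replicate_mset t P"] t
        by (metis of_nat_le_iff order_trans size_replicate_mset)
      ultimately show ?thesis
        using \<open>P \<in> C\<close> by (intro exI[of _ "replicate_mset t P"]) auto
    next
      case False
      define t where "t = nat \<lceil>l * f\<rceil>"
      have "0 \<le> l * f" using False l by simp
      then have t: "l * f \<le> real t" "real t \<le> l * f + 1"
        unfolding t_def by linarith+
      have light: "\<exists>P\<in>C. f * (\<Sum>F | F \<in> \<F> \<and> set P \<inter> F \<noteq> {}. w F) \<le> (\<Sum>F\<in>\<F>. w F)"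
        if w: "\<And>F. F \<in> \<F> \<Longrightarrow> w F > 0" for w
      proof -
        obtain P where P: "induced_AB_path G A B P"
          "f * (\<Sum>F | F \<in> \<F> \<and> F \<inter> set P \<noteq> {}. w F) \<le> (\<Sum>F\<in>\<F>. w F)"
          using exists_light_path[of \<F> G A B P0 w] fin P0 hits w unfolding f_def by blast
        obtain P' where P': "P' \<in> C" "\<forall>F\<in>\<F>. F \<inter> set P' \<noteq> {} \<longrightarrow> F \<inter> set P \<noteq> {}"
          using thin[OF P(1)] by blast
        \<comment> \<open>The thin replacement meets no new members, so it is at least as light as
          \<open>P\<close>.\<close>
        have "(\<Sum>F | F \<in> \<F> \<and> set P' \<inter> F \<noteq> {}. w F) \<le> (\<Sum>F | F \<in> \<F> \<and> F \<inter> set P \<noteq> {}. w F)"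
          using P' w fin by (intro sum_mono2) (auto simp: less_imp_le)
        then have "f * (\<Sum>F | F \<in> \<F> \<and> set P' \<inter> F \<noteq> {}. w F) \<le>
            f * (\<Sum>F | F \<in> \<F> \<and> F \<inter> set P \<noteq> {}. w F)"
          using False by (intro mult_left_mono) auto
        then show ?thesis using P P' by (intro bexI[of _ P']) auto
      qed
      obtain Q where Q: "size Q = t" "set_mset Q \<subseteq> C"
        "(\<Sum>F\<in>\<F>. 4 ^ size {#P \<in># Q. set P \<inter> F \<noteq> {}#}) \<le> real (card \<F>) * (1 + 3 / f) ^ t"
        using greedy_packing[of \<F> f C "\<lambda>P F. set P \<inter> F \<noteq> {}" t] fin False light by auto
      have "real (size {#P \<in># Q. set P \<inter> F \<noteq> {}#}) \<le> 6 * l" if "F \<in> \<F>" for F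
      proof (rule greedy_weight_bound)
        \<comment> \<open>A single term is bounded by the total weight, which turns the bound on the
          potential into one for each member.\<close>
        have "(4 :: real) ^ size {#P \<in># Q. set P \<inter> F \<noteq> {}#} \<le>
            (\<Sum>F\<in>\<F>. 4 ^ size {#P \<in># Q. set P \<inter> F \<noteq> {}#})"
          using fin that by (intro member_le_sum) auto
        also note Q(3)
        finally show "4 ^ size {#P \<in># Q. set P \<inter> F \<noteq> {}#} \<le> real (card \<F>) * (1 + 3 / f) ^ t" .
      qed (use False t card_le l in auto)
      then show ?thesis using Q t by blast
    qed
    then show ?thesis by (auto simp: C_def f_def subset_iff)
  qed
qed

end
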